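(* The knot quandle of the trefoil knot is neither left-orderable nor right-orderable.
   Context: The trefoil knot is the torus knot $T(2,3)$, the closure of the 2-strand braid $\sigma_1^3$. A quandle is a non-empty set $Q$ with a binary operation $*$ such that $x*x=x$; for all $x,y$ there is a unique $z$ (denoted $x*^{-1}y$) with $x=z*y$; and $(x*y)*z=(x*z)*(y*z)$. $Q$ is left-orderable (resp. right-orderable) if it has a (strict) linear order $<$ such that $x<y$ implies $z*x<z*y$ (resp. $x*z<y*z$) for all $x,y,z\in Q$. The knot quandle of an oriented knot in the 3-sphere is the quandle presented by generators the arcs of a diagram and one relation per crossing: if $y$ is the over arc and $x$, $z$ are the incoming and outgoing under arcs, then $z=x*y$ if the crossing is positive and $z=x*^{-1}y$ if it is negative; up to isomorphism it does not depend on the diagram. *)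

theory Defs
  imports Main
begin

section \<open>Quandles and their orderings\<close>

record 'a quandle_struct =
  carrier :: "'a set"
  qop :: "'a \<Rightarrow> 'a \<Rightarrow> 'a"

definition quandle :: "'a quandle_struct \<Rightarrow> bool" where
  "quandle Q \<longleftrightarrow>
     carrier Q \<noteq> {} \<and>
     (\<forall>x\<in>carrier Q. \<forall>y\<in>carrier Q. qop Q x y \<in> carrier Q) \<and>
     (\<forall>x\<in>carrier Q. qop Q x x = x) \<and>
     (\<forall>x\<in>carrier Q. \<forall>y\<in>carrier Q. \<exists>!z. z \<in> carrier Q \<and> x = qop Q z y) \<and>
     (\<forall>x\<in>carrier Q. \<forall>y\<in>carrier Q. \<forall>z\<in>carrier Q.
        qop Q (qop Q x y) z = qop Q (qop Q x z) (qop Q y z))"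

definition left_orderable :: "'a quandle_struct \<Rightarrow> bool" where
  "left_orderable Q \<longleftrightarrow>
     (\<exists>less. strict_linear_order_on (carrier Q) less \<and>
        (\<forall>x\<in>carrier Q. \<forall>y\<in>carrier Q. \<forall>z\<in>carrier Q.
           (x, y) \<in> less \<longrightarrow> (qop Q z x, qop Q z y) \<in> less))"

definition right_orderable :: "'a quandle_struct \<Rightarrow> bool" where
  "right_orderable Q \<longleftrightarrow>
     (\<exists>less. strict_linear_order_on (carrier Q) less \<and>
        (\<forall>x\<in>carrier Q. \<forall>y\<in>carrier Q. \<forall>z\<in>carrier Q.
           (x, y) \<in> less \<longrightarrow> (qop Q x z, qop Q y z) \<in> less))"


section \<open>Quandles given by generators and relations\<close>

text \<open>\<open>QInv s t\<close> is the formal \<open>s *\<^sup>-\<^sup>1 t\<close>.\<close>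

datatype 'a qterm =
    QGen 'a
  | QOp "'a qterm" "'a qterm"
  | QInv "'a qterm" "'a qterm"

definition qterms :: "'a set \<Rightarrow> 'a qterm set" where
  "qterms X = {t. set_qterm t \<subseteq> X}"

text \<open>
  The least congruence on the terms over \<open>X\<close> that contains the relations \<open>R\<close> and
  all instances of the quandle axioms. The two cancellation rules express that right
  multiplication by \<open>t\<close> is a bijection with inverse \<open>*\<^sup>-\<^sup>1 t\<close>.
\<close>

inductive_set qcong :: "'a set \<Rightarrow> ('a qterm \<times> 'a qterm) set \<Rightarrow> ('a qterm \<times> 'a qterm) set"
  for X R where
  rel: "(s, t) \<in> R \<Longrightarrow> s \<in> qterms X \<Longrightarrow> t \<in> qterms X \<Longrightarrow> (s, t) \<in> qcong X R"
| refl: "s \<in> qterms X \<Longrightarrow> (s, s) \<in> qcong X R"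
| sym: "(s, t) \<in> qcong X R \<Longrightarrow> (t, s) \<in> qcong X R"
| trans: "(s, t) \<in> qcong X R \<Longrightarrow> (t, u) \<in> qcong X R \<Longrightarrow> (s, u) \<in> qcong X R"
| op: "(s, s') \<in> qcong X R \<Longrightarrow> (t, t') \<in> qcong X R \<Longrightarrow>
    (QOp s t, QOp s' t') \<in> qcong X R"
| inv: "(s, s') \<in> qcong X R \<Longrightarrow> (t, t') \<in> qcong X R \<Longrightarrow>
    (QInv s t, QInv s' t') \<in> qcong X R"
| idem: "s \<in> qterms X \<Longrightarrow> (QOp s s, s) \<in> qcong X R"
| op_inv: "s \<in> qterms X \<Longrightarrow> t \<in> qterms X \<Longrightarrow> (QOp (QInv s t) t, s) \<in> qcong X R"
| inv_op: "s \<in> qterms X \<Longrightarrow> t \<in> qterms X \<Longrightarrow> (QInv (QOp s t) t, s) \<in> qcong X R"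
| distrib: "s \<in> qterms X \<Longrightarrow> t \<in> qterms X \<Longrightarrow> u \<in> qterms X \<Longrightarrow>
    (QOp (QOp s t) u, QOp (QOp s u) (QOp t u)) \<in> qcong X R"

definition presented_quandle ::
    "'a set \<Rightarrow> ('a qterm \<times> 'a qterm) set \<Rightarrow> 'a qterm set quandle_struct" where
  "presented_quandle X R =
     \<lparr> carrier = qterms X // qcong X R,
       qop = (\<lambda>A B. \<Union>s\<in>A. \<Union>t\<in>B. qcong X R `` {QOp s t}) \<rparr>"

lemma qterms_simps [simp]:
  "QGen a \<in> qterms X \<longleftrightarrow> a \<in> X"
  "QOp s t \<in> qterms X \<longleftrightarrow> s \<in> qterms X \<and> t \<in> qterms X"
  "QInv s t \<in> qterms X \<longleftrightarrow> s \<in> qterms X \<and> t \<in> qterms X"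
  by (auto simp: qterms_def)

lemma qcong_qterms: "(s, t) \<in> qcong X R \<Longrightarrow> s \<in> qterms X \<and> t \<in> qterms X"
  by (induction rule: qcong.induct) auto

lemma equiv_qcong: "equiv (qterms X) (qcong X R)"
proof (rule equivI)
  show "qcong X R \<subseteq> qterms X \<times> qterms X"
    using qcong_qterms by fast
  show "refl_on (qterms X) (qcong X R)"
    by (rule refl_onI) (rule qcong.refl)
  show "sym (qcong X R)"
    by (rule symI) (rule qcong.sym)
  show "trans (qcong X R)"
    by (rule transI) (rule qcong.trans)
qed

lemma qop_presented_quandle:
  assumes "s \<in> qterms X" "t \<in> qterms X"
  shows "qop (presented_quandle X R) (qcong X R `` {s}) (qcong X R `` {t}) =
    qcong X R `` {QOp s t}"
proof -
  have "(\<lambda>s t. qcong X R `` {QOp s t}) respects2 (qcong X R)"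
    by (rule congruent2I') (rule equiv_class_eq[OF equiv_qcong qcong.op])
  from UN_equiv_class2[OF equiv_qcong equiv_qcong this assms]
  show ?thesis
    by (simp only: presented_quandle_def quandle_struct.simps)
qed

theorem quandle_presented_quandle:
  assumes "X \<noteq> {}"
  shows "quandle (presented_quandle X R)"
proof -
  let ?Q = "presented_quandle X R" and ?c = "\<lambda>s. qcong X R `` {s}"
  have carr: "carrier ?Q = ?c ` qterms X"
    by (auto simp: presented_quandle_def quotient_def)
  have eq: "?c s = ?c t" if "(s, t) \<in> qcong X R" for s t
    by (rule equiv_class_eq[OF equiv_qcong that])
  have eqD: "(s, t) \<in> qcong X R" if "?c s = ?c t" "t \<in> qterms X" for s t
    by (rule eq_equiv_class[OF that(1) equiv_qcong that(2)])
  have op: "qop ?Q (?c s) (?c t) = ?c (QOp s t)" if "s \<in> qterms X" "t \<in> qterms X" for s t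
    by (rule qop_presented_quandle[OF that])
  obtain a where "a \<in> X" using assms by auto
  then have "QGen a \<in> qterms X" by simp
  then have nonempty: "carrier ?Q \<noteq> {}" unfolding carr by blast
  have divisible: "\<exists>!z. z \<in> carrier ?Q \<and> ?c s = qop ?Q z (?c t)"
    if st: "s \<in> qterms X" "t \<in> qterms X" for s t
  proof (rule ex1I[of _ "?c (QInv s t)"])
    show "?c (QInv s t) \<in> carrier ?Q \<and> ?c s = qop ?Q (?c (QInv s t)) (?c t)"
      using st eq[OF qcong.op_inv[OF st]] by (simp add: carr op)
  next
    fix z assume z: "z \<in> carrier ?Q \<and> ?c s = qop ?Q z (?c t)"
    then obtain u where u: "u \<in> qterms X" "z = ?c u" by (auto simp: carr)
    then have "(s, QOp u t) \<in> qcong X R" using z st by (intro eqD) (simp_all add: op)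
    then have "(QInv s t, QInv (QOp u t) t) \<in> qcong X R"
      using qcong.refl[OF st(2)] by (rule qcong.inv)
    then have "(QInv s t, u) \<in> qcong X R"
      using qcong.inv_op[OF u(1) st(2)] by (rule qcong.trans)
    from eq[OF this] show "z = ?c (QInv s t)" unfolding u(2) by (rule HOL.sym)
  qed
  have rep: "\<exists>s\<in>qterms X. x = ?c s" if "x \<in> carrier ?Q" for x
    using that by (auto simp: carr)
  show ?thesis
    unfolding quandle_def
  proof (intro conjI ballI)
    fix x assume "x \<in> carrier ?Q"
    then obtain s where s: "s \<in> qterms X" "x = ?c s" using rep by blast
    then show "qop ?Q x x = x" by (simp add: op eq[OF qcong.idem])
    fix y assume "y \<in> carrier ?Q"
    then obtain t where t: "t \<in> qterms X" "y = ?c t" using rep by blast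
    show "qop ?Q x y \<in> carrier ?Q" using s t by (simp add: op carr)
    show "\<exists>!z. z \<in> carrier ?Q \<and> x = qop ?Q z y"
      unfolding s(2) t(2) by (rule divisible[OF s(1) t(1)])
    fix z assume "z \<in> carrier ?Q"
    then obtain u where u: "u \<in> qterms X" "z = ?c u" using rep by blast
    show "qop ?Q (qop ?Q x y) z = qop ?Q (qop ?Q x z) (qop ?Q y z)"
      using s t u eq[OF qcong.distrib[OF s(1) t(1) u(1)]] by (simp add: op)
  qed (rule nonempty)
qed


section \<open>The knot quandle of a diagram\<close>

text \<open>
  Only the part of an oriented diagram that enters the knot quandle: its arcs, and for
  each crossing its sign, its over arc and its incoming and outgoing under arcs.
\<close>

record 'a crossing =
  positive :: bool
  over :: 'a
  under_in :: 'a
  under_out :: 'a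

record 'a diagram =
  arcs :: "'a set"
  crossings :: "'a crossing list"

definition crossing_relation :: "'a crossing \<Rightarrow> 'a qterm \<times> 'a qterm" where
  "crossing_relation c =
     (QGen (under_out c),
      if positive c then QOp (QGen (under_in c)) (QGen (over c))
      else QInv (QGen (under_in c)) (QGen (over c)))"

definition knot_quandle :: "'a diagram \<Rightarrow> 'a qterm set quandle_struct" where
  "knot_quandle D = presented_quandle (arcs D) (crossing_relation ` set (crossings D))"


section \<open>Closed braids\<close>

text \<open>
  A word in the braid group on \<open>n\<close> strands is a list of non-zero integers of absolute
  value less than \<open>n\<close>, where \<open>i\<close> stands for \<open>\<sigma>\<^sub>i\<close> and \<open>-i\<close> for its inverse. The
  \<open>k\<close>-th letter (counting from \<open>0\<close>) is drawn between level \<open>k\<close> and level \<open>Suc k\<close>; the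
  strands are oriented towards increasing levels, and the point \<open>(k, p)\<close> is at level
  \<open>k\<close> on position \<open>p \<in> {1..n}\<close>. In \<open>\<sigma>\<^sub>i\<close> the strand going from position \<open>i\<close> to \<open>i + 1\<close>
  passes over the one going from \<open>i + 1\<close> to \<open>i\<close>, which is a positive crossing; in the
  inverse of \<open>\<sigma>\<^sub>i\<close> it passes under, and the crossing is negative.
\<close>

type_synonym point = "nat \<times> nat"

definition braid_points :: "nat \<Rightarrow> int list \<Rightarrow> point set" where
  "braid_points n w = {0..length w} \<times> {1..n}"

definition over_start :: "int list \<Rightarrow> nat \<Rightarrow> point" where
  "over_start w k = (let i = nat \<bar>w ! k\<bar> in (k, if w ! k > 0 then i else Suc i))"

definition over_end :: "int list \<Rightarrow> nat \<Rightarrow> point" where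
  "over_end w k = (let i = nat \<bar>w ! k\<bar> in (Suc k, if w ! k > 0 then Suc i else i))"

definition under_start :: "int list \<Rightarrow> nat \<Rightarrow> point" where
  "under_start w k = (let i = nat \<bar>w ! k\<bar> in (k, if w ! k > 0 then Suc i else i))"

definition under_end :: "int list \<Rightarrow> nat \<Rightarrow> point" where
  "under_end w k = (let i = nat \<bar>w ! k\<bar> in (Suc k, if w ! k > 0 then i else Suc i))"

text \<open>
  The points joined by a piece of the closed braid that does not pass under: the strands
  not involved in a letter, the over strand of a letter, and the closing strands.
\<close>

inductive joined :: "nat \<Rightarrow> int list \<Rightarrow> point \<Rightarrow> point \<Rightarrow> bool" for n w where
  straight: "k < length w \<Longrightarrow> p \<in> {1..n} \<Longrightarrow> p \<noteq> nat \<bar>w ! k\<bar> \<Longrightarrow> p \<noteq> Suc (nat \<bar>w ! k\<bar>) \<Longrightarrow>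
    joined n w (k, p) (Suc k, p)"
| over: "k < length w \<Longrightarrow> joined n w (over_start w k) (over_end w k)"
| closing: "p \<in> {1..n} \<Longrightarrow> joined n w (length w, p) (0, p)"

definition arc_of :: "nat \<Rightarrow> int list \<Rightarrow> point \<Rightarrow> point set" where
  "arc_of n w x = {y. equivclp (joined n w) x y}"

definition closed_braid :: "nat \<Rightarrow> int list \<Rightarrow> point set diagram" where
  "closed_braid n w =
     \<lparr> arcs = arc_of n w ` braid_points n w,
       crossings = map (\<lambda>k.
         \<lparr> positive = (w ! k > 0),
           over = arc_of n w (over_start w k),
           under_in = arc_of n w (under_start w k),
           under_out = arc_of n w (under_end w k) \<rparr>) [0..<length w] \<rparr>"

definition trefoil :: "point set diagram" where
  "trefoil = closed_braid 2 [1, 1, 1]"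

lemma quandle_knot_quandle_trefoil: "quandle (knot_quandle trefoil)"
  unfolding knot_quandle_def
  by (rule quandle_presented_quandle)
     (simp add: trefoil_def closed_braid_def braid_points_def)

end

theory Submission
  imports Defs
begin

text \<open>
  The three arcs of the trefoil satisfy \<open>a * b = c\<close>, \<open>b * c = a\<close>, \<open>c * a = b\<close>, and they are
  distinct elements of the knot quandle because the diagram has a non-constant Fox
  3-colouring. Multiplying the order relations among \<open>a\<close>, \<open>b\<close>, \<open>c\<close> by suitable arcs
  on the left, or on the right, yields a contradiction.
\<close>

lemma not_orderable_if_cyclic_triple:
  assumes mem: "a \<in> carrier Q" "b \<in> carrier Q" "c \<in> carrier Q"
    and idem: "\<And>x. x \<in> carrier Q \<Longrightarrow> qop Q x x = x"
    and cyc: "qop Q a b = c" "qop Q b c = a" "qop Q c a = b"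
    and distinct: "a \<noteq> b" "b \<noteq> c" "a \<noteq> c"
  shows "\<not> left_orderable Q" and "\<not> right_orderable Q"
proof -
  note products = cyc idem[OF mem(1)] idem[OF mem(2)] idem[OF mem(3)]
  show "\<not> left_orderable Q"
  proof
    assume "left_orderable Q"
    then obtain L where L: "strict_linear_order_on (carrier Q) L"
      and mono: "\<And>x y z. x \<in> carrier Q \<Longrightarrow> y \<in> carrier Q \<Longrightarrow> z \<in> carrier Q \<Longrightarrow>
        (x, y) \<in> L \<Longrightarrow> (qop Q z x, qop Q z y) \<in> L"
      unfolding left_orderable_def by blast
    have irr: "(x, x) \<notin> L" and tr: "(x, y) \<in> L \<Longrightarrow> (y, z) \<in> L \<Longrightarrow> (x, z) \<in> L"
      and total: "x \<in> carrier Q \<Longrightarrow> y \<in> carrier Q \<Longrightarrow> x \<noteq> y \<Longrightarrow> (x, y) \<in> L \<or> (y, x) \<in> L"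
      for x y z
      using L by (auto simp: strict_linear_order_on_def irrefl_def total_on_def dest: transD)
    \<comment> \<open>Each factor on the left is one of the two compared elements: idempotence fixes
      it and a cyclic product moves the other. The implications close into a cycle through both
      comparisons of \<open>a\<close> and \<open>b\<close>, so either one forces its
      reverse.\<close>
    have "(a, b) \<in> L \<Longrightarrow> (a, c) \<in> L" "(a, c) \<in> L \<Longrightarrow> (b, c) \<in> L" "(b, c) \<in> L \<Longrightarrow> (b, a) \<in> L"
      "(b, a) \<in> L \<Longrightarrow> (c, a) \<in> L" "(c, a) \<in> L \<Longrightarrow> (c, b) \<in> L" "(c, b) \<in> L \<Longrightarrow> (a, b) \<in> L"
      using mono[of a b a] mono[of a c c] mono[of b c b]
        mono[of b a a] mono[of c a c] mono[of c b b] mem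
      by (simp_all add: products)
    then show False
      using total[OF mem(1,2) distinct(1)] irr tr by blast
  qed
  show "\<not> right_orderable Q"
  proof
    assume "right_orderable Q"
    then obtain L where L: "strict_linear_order_on (carrier Q) L"
      and mono: "\<And>x y z. x \<in> carrier Q \<Longrightarrow> y \<in> carrier Q \<Longrightarrow> z \<in> carrier Q \<Longrightarrow>
        (x, y) \<in> L \<Longrightarrow> (qop Q x z, qop Q y z) \<in> L"
      unfolding right_orderable_def by blast
    have irr: "(x, x) \<notin> L" and tr: "(x, y) \<in> L \<Longrightarrow> (y, z) \<in> L \<Longrightarrow> (x, z) \<in> L"
      and total: "x \<in> carrier Q \<Longrightarrow> y \<in> carrier Q \<Longrightarrow> x \<noteq> y \<Longrightarrow> (x, y) \<in> L \<or> (y, x) \<in> L"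
      for x y z
      using L by (auto simp: strict_linear_order_on_def irrefl_def total_on_def dest: transD)
    \<comment> \<open>The same kind of cycle, now with the factor on the right; again it passes
      through both comparisons of \<open>a\<close> and \<open>b\<close>.\<close>
    have "(a, b) \<in> L \<Longrightarrow> (c, b) \<in> L" "(c, b) \<in> L \<Longrightarrow> (c, a) \<in> L" "(c, a) \<in> L \<Longrightarrow> (b, a) \<in> L"
      "(b, a) \<in> L \<Longrightarrow> (b, c) \<in> L" "(b, c) \<in> L \<Longrightarrow> (a, c) \<in> L" "(a, c) \<in> L \<Longrightarrow> (a, b) \<in> L"
      using mono[of a b b] mono[of c b c] mono[of c a a]
        mono[of b a b] mono[of b c c] mono[of a c a] mem
      by (simp_all add: products)
    then show False
      using total[OF mem(1,2) distinct(1)] irr tr by blast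
  qed
qed

text \<open>
  Terms are evaluated in the dihedral quandle \<open>x * y = 2 y - x\<close>, where right
  multiplication is an involution, so that \<open>*\<^sup>-\<^sup>1\<close> and \<open>*\<close> coincide.
\<close>

primrec fox_value :: "('a \<Rightarrow> int) \<Rightarrow> 'a qterm \<Rightarrow> int" where
  "fox_value f (QGen x) = f x"
| "fox_value f (QOp s t) = 2 * fox_value f t - fox_value f s"
| "fox_value f (QInv s t) = 2 * fox_value f t - fox_value f s"

text \<open>The quandle axioms hold exactly for \<open>2 * y - x\<close> over the integers, so only
  the relations in \<open>R\<close> need the modulus. Working with divisibility avoids a separate
  type of residues.\<close>

lemma fox_value_qcong:
  assumes "(s, t) \<in> qcong X R"
    and "\<And>s t. (s, t) \<in> R \<Longrightarrow> m dvd fox_value f s - fox_value f t"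
  shows "m dvd fox_value f s - fox_value f t"
  using assms(1)
proof induction
  case (rel s t)
  then show ?case by (simp add: assms(2))
next
  case (sym s t)
  then show ?case by (simp add: dvd_diff_commute)
next
  case (trans s t u)
  from dvd_add[OF trans.IH] show ?case by simp
next
  case (op s s' t t')
  from dvd_diff[OF dvd_mult[OF op.IH(2), of 2] op.IH(1)] show ?case
    by (simp add: algebra_simps)
next
  case (inv s s' t t')
  from dvd_diff[OF dvd_mult[OF inv.IH(2), of 2] inv.IH(1)] show ?case
    by (simp add: algebra_simps)
qed simp_all

lemma arc_of_eq_if_joined:
  assumes "joined n w x y"
  shows "arc_of n w x = arc_of n w y"
proof -
  have "equivclp (joined n w) x y"
    using assms by (rule r_into_equivclp)
  then show ?thesis
    unfolding arc_of_def by (blast intro: equivclp_trans equivclp_sym)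
qed

text \<open>Equality of \<open>g\<close> propagates along chains of joined points, so it does not
  matter which point \<open>SOME\<close> picks. This turns a colouring of points into one of arcs,
  which are sets of points.\<close>

lemma some_in_arc_of:
  fixes g :: "point \<Rightarrow> 'b"
  assumes "\<And>x y. joined n w x y \<Longrightarrow> g x = g y"
  shows "g (SOME y. y \<in> arc_of n w x) = g x"
proof -
  have inv: "g x = g y" if "equivclp (joined n w) x y" for y
    using that by (induction rule: equivclp_induct) (auto dest: assms)
  have "x \<in> arc_of n w x"
    by (simp add: arc_of_def)
  then have "(SOME y. y \<in> arc_of n w x) \<in> arc_of n w x"
    by (rule someI)
  then show ?thesis
    using inv by (simp add: arc_of_def)
qed

abbreviation trefoil_arc :: "nat \<Rightarrow> nat \<Rightarrow> point set" where
  "trefoil_arc k p \<equiv> arc_of 2 [1, 1, 1] (k, p)"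

lemma trefoil_letter: "k < 3 \<Longrightarrow> [1, 1, 1 :: int] ! k = 1"
  by (auto simp: less_Suc_eq numeral_3_eq_3)

lemma arcs_trefoil: "k \<le> 3 \<Longrightarrow> p \<in> {1..2} \<Longrightarrow> trefoil_arc k p \<in> arcs trefoil"
  by (auto simp: trefoil_def closed_braid_def braid_points_def)

lemma trefoil_arc_over: "k < 3 \<Longrightarrow> trefoil_arc (Suc k) 2 = trefoil_arc k 1"
  using arc_of_eq_if_joined[OF joined.over[of k "[1, 1, 1]" 2]]
  by (simp add: over_start_def over_end_def trefoil_letter numeral_2_eq_2)

lemma trefoil_arc_closing: "p \<in> {1..2} \<Longrightarrow> trefoil_arc 3 p = trefoil_arc 0 p"
  using arc_of_eq_if_joined[OF joined.closing[of p 2 "[1, 1, 1]"]]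
  by (simp add: numeral_3_eq_3)

lemma crossing_relations_trefoil:
  "crossing_relation ` set (crossings trefoil) =
    (\<lambda>k. (QGen (trefoil_arc (Suc k) 1), QOp (QGen (trefoil_arc k 2)) (QGen (trefoil_arc k 1))))
      ` {0..<3}"
  unfolding trefoil_def closed_braid_def diagram.simps set_map image_image set_upt
  by (rule image_cong)
    (simp_all add: crossing_relation_def over_start_def under_start_def under_end_def
      trefoil_letter eval_nat_numeral)

text \<open>Level minus position is the colour: an over strand raises both by one, and a closing
  strand changes the level by 3. With two strands, each letter involves both positions, so the
  straight case is vacuous.\<close>

lemma trefoil_colour_joined:
  assumes "joined 2 [1, 1, 1] x y"
  shows "(int (fst x) - int (snd x)) mod 3 = (int (fst y) - int (snd y)) mod 3"
  using assms
proof cases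
  case (straight k p)
  then show ?thesis by (auto simp: trefoil_letter)
next
  case (over k)
  then show ?thesis by (simp add: over_start_def over_end_def trefoil_letter)
next
  case (closing p)
  then show ?thesis by (simp add: mod_eq_dvd_iff)
qed

definition trefoil_colour :: "point set \<Rightarrow> int" where
  "trefoil_colour U = (let x = SOME x. x \<in> U in (int (fst x) - int (snd x)) mod 3)"

lemma trefoil_colour_arc: "trefoil_colour (trefoil_arc k p) = (int k - int p) mod 3"
  using some_in_arc_of[where g = "\<lambda>x. (int (fst x) - int (snd x)) mod 3",
      OF trefoil_colour_joined]
  by (simp add: trefoil_colour_def Let_def)

text \<open>At crossing \<open>k\<close> the incoming, over and outgoing arcs have colours
  \<open>k - 2\<close>, \<open>k - 1\<close>, \<open>k\<close> modulo 3, and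
  \<open>2 * (k - 1) - (k - 2) = k\<close>.\<close>

lemma trefoil_colour_relations:
  assumes "(s, t) \<in> crossing_relation ` set (crossings trefoil)"
  shows "3 dvd fox_value trefoil_colour s - fox_value trefoil_colour t"
proof -
  obtain k where "s = QGen (trefoil_arc (Suc k) 1)"
    "t = QOp (QGen (trefoil_arc k 2)) (QGen (trefoil_arc k 1))"
    using assms unfolding crossing_relations_trefoil by auto
  then show ?thesis
    by (simp add: trefoil_colour_arc) presburger
qed

theorem corollary7p4:
  shows "\<not> left_orderable (knot_quandle trefoil) \<and> \<not> right_orderable (knot_quandle trefoil)"
proof -
  let ?Q = "knot_quandle trefoil" and ?X = "arcs trefoil"
    and ?R = "crossing_relation ` set (crossings trefoil)"
  define e where "e k p = qcong ?X ?R `` {QGen (trefoil_arc k p)}" for k p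
  have carrier: "e k p \<in> carrier ?Q" if "k \<le> 3" "p \<in> {1..2}" for k p
    using arcs_trefoil[OF that]
    by (auto simp: e_def knot_quandle_def presented_quandle_def intro: quotientI)
  have crossing: "qop ?Q (e k 2) (e k 1) = e (Suc k) 1" if "k < 3" for k
  proof -
    have gens: "QGen (trefoil_arc k 2) \<in> qterms ?X" "QGen (trefoil_arc k 1) \<in> qterms ?X"
      "QGen (trefoil_arc (Suc k) 1) \<in> qterms ?X"
      using that by (simp_all add: arcs_trefoil)
    have "(QGen (trefoil_arc (Suc k) 1),
        QOp (QGen (trefoil_arc k 2)) (QGen (trefoil_arc k 1))) \<in> qcong ?X ?R"
      using that gens by (intro qcong.rel) (auto simp: crossing_relations_trefoil)
    then show ?thesis
      unfolding e_def knot_quandle_def qop_presented_quandle[OF gens(1,2)]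
      by (rule equiv_class_eq[OF equiv_qcong, symmetric])
  qed
  have over: "e (Suc k) 2 = e k 1" if "k < 3" for k
    using that by (simp add: e_def trefoil_arc_over)
  have closing: "e 3 p = e 0 p" if "p \<in> {1..2}" for p
    using that by (simp add: e_def trefoil_arc_closing)
  \<comment> \<open>The over strand identifies \<open>e k 2\<close> with \<open>e (k - 1) 1\<close>,
    and the closing strands make levels cyclic modulo 3. Each crossing thus multiplies two
    consecutive elements among \<open>e 0 1\<close>, \<open>e 1 1\<close>, \<open>e 2 1\<close> to
    give the third.\<close>
  have cyc: "qop ?Q (e 0 1) (e 1 1) = e 2 1" "qop ?Q (e 1 1) (e 2 1) = e 0 1"
    "qop ?Q (e 2 1) (e 0 1) = e 1 1"
    using crossing[of 0] crossing[of 1] crossing[of 2] over[of 0] over[of 1] over[of 2]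
      closing[of 1] closing[of 2]
    by (simp_all add: eval_nat_numeral)
  have distinct: "e j 1 \<noteq> e k 1" if "j < k" "k < 3" for j k
  proof
    assume "e j 1 = e k 1"
    then have "(QGen (trefoil_arc j 1), QGen (trefoil_arc k 1)) \<in> qcong ?X ?R"
      unfolding e_def using that
      by (intro eq_equiv_class[OF _ equiv_qcong]) (simp_all add: arcs_trefoil)
    \<comment> \<open>The arcs through position 1 at levels 0, 1, 2 have the colours 2, 0, 1, no two
      of which are congruent modulo 3.\<close>
    from fox_value_qcong[OF this trefoil_colour_relations]
    have "3 dvd (int j - 1) mod 3 - (int k - 1) mod 3"
      by (simp add: trefoil_colour_arc)
    with that show False by presburger
  qed
  have idem: "qop ?Q x x = x" if "x \<in> carrier ?Q" for x
    using quandle_knot_quandle_trefoil that by (simp add: quandle_def)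
  have mem: "e 0 1 \<in> carrier ?Q" "e 1 1 \<in> carrier ?Q" "e 2 1 \<in> carrier ?Q"
    by (simp_all add: carrier)
  have neq: "e 0 1 \<noteq> e 1 1" "e 1 1 \<noteq> e 2 1" "e 0 1 \<noteq> e 2 1"
    by (simp_all add: distinct del: One_nat_def)
  show ?thesis
    using not_orderable_if_cyclic_triple[OF mem idem cyc neq] by blast
qed

end
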